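(* Let $N\ge 2$, let $\mathcal H$ be an $N$-dimensional complex Hilbert space with fixed orthonormal basis $\{|\mu\rangle\}_{\mu=0}^{N-1}$, and let $\Lambda$ be (the map of) an attractor quantum neural network (aQNN) on $\mathcal H$, i.e. a completely positive trace-preserving (CPTP) map of the form $$\Lambda(\rho)=\sum_{\mu=0}^{N-1}\rho_{\mu\mu}|\mu\rangle\langle\mu|+\sum_{\mu<\nu}\Big[\rho_{\mu\nu}(1+\alpha_{\mu\nu})|\mu\rangle\langle\nu|+\mathrm{h.c.}\Big],\qquad \alpha_{\mu\nu}\in\mathbb C .$$ Then $\Lambda$ is a genuinely incoherent operation (GIO) with respect to the basis $\{|\mu\rangle\}$.
   Context: Here $\rho_{\mu\nu}=\langle\mu|\rho|\nu\rangle$, and h.c. denotes the Hermitian conjugate for Hermitian $\rho$ (so, extending linearly, $|\nu\rangle\langle\mu|$ is multiplied by $1+\overline{\alpha_{\mu\nu}}$ for $\mu<\nu$). The set of incoherent states $\mathbb I$ is the set of density operators on $\mathcal H$ that are diagonal in the basis $\{|\mu\rangle\}$. A CPTP map $\mathcal E$ is a strictly incoherent operation (SIO) if it has a Kraus representation $\mathcal E(\cdot)=\sum_a K_a\cdot K_a^\dagger$ such that for every $a$ and every $\delta\in\mathbb I$ both $K_a\delta K_a^\dagger$ and $K_a^\dagger\delta K_a$ are diagonal in the basis (incoherent up to normalization). A genuinely incoherent operation (GIO) is an SIO that satisfies $\mathcal E(\delta)=\delta$ for all $\delta\in\mathbb I$. *)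

theory Defs
  imports "Jordan_Normal_Form.Schur_Decomposition"
begin

text \<open>Operators on an \<open>N\<close>-dimensional Hilbert space with a fixed orthonormal basis
  \<open>|0\<rangle>, \<dots>, |N-1\<rangle>\<close> are identified with their matrices in that basis:
  \<open>\<rho> $$ (\<mu>, \<nu>) = \<langle>\<mu>|\<rho>|\<nu>\<rangle>\<close>.  Maps on operators are HOL functions of which only the values on
  \<^term>\<open>carrier_mat N N\<close> matter.\<close>

text \<open>Matrices of unspecified size do not form a commutative monoid, so \<^const>\<open>sum\<close> is not
  available on them.\<close>

definition mat_sum :: "nat \<Rightarrow> ('i \<Rightarrow> complex mat) \<Rightarrow> 'i set \<Rightarrow> complex mat" where
  "mat_sum N f I = mat N N (\<lambda>(\<mu>, \<nu>). \<Sum>i\<in>I. f i $$ (\<mu>, \<nu>))"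

definition ketbra :: "nat \<Rightarrow> nat \<Rightarrow> nat \<Rightarrow> complex mat" where
  "ketbra N \<mu> \<nu> = mat N N (\<lambda>(i, j). if i = \<mu> \<and> j = \<nu> then 1 else 0)"

text \<open>The order on \<^typ>\<open>complex\<close> makes \<open>0 \<le> z\<close> mean that \<open>z\<close> is real and nonnegative; over
  \<open>\<complex>\<close> this condition on all \<open>\<langle>v, A v\<rangle>\<close> includes that \<open>A\<close> is Hermitian.\<close>

definition positive_op :: "nat \<Rightarrow> complex mat \<Rightarrow> bool" where
  "positive_op n A \<longleftrightarrow>
     A \<in> carrier_mat n n \<and> (\<forall>v \<in> carrier_vec n. 0 \<le> (A *\<^sub>v v) \<bullet>c v)"

definition mat_trace :: "complex mat \<Rightarrow> complex" where
  "mat_trace A = (\<Sum>i<dim_row A. A $$ (i, i))"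

definition density_op :: "nat \<Rightarrow> complex mat \<Rightarrow> bool" where
  "density_op N \<rho> \<longleftrightarrow> positive_op N \<rho> \<and> mat_trace \<rho> = 1"

definition incoherent_states :: "nat \<Rightarrow> complex mat set" where
  "incoherent_states N = {\<delta>. density_op N \<delta> \<and> diagonal_mat \<delta>}"

definition linear_op_map :: "nat \<Rightarrow> (complex mat \<Rightarrow> complex mat) \<Rightarrow> bool" where
  "linear_op_map N \<Phi> \<longleftrightarrow>
     (\<forall>A \<in> carrier_mat N N. \<Phi> A \<in> carrier_mat N N) \<and>
     (\<forall>A \<in> carrier_mat N N. \<forall>B \<in> carrier_mat N N. \<Phi> (A + B) = \<Phi> A + \<Phi> B) \<and>
     (\<forall>c. \<forall>A \<in> carrier_mat N N. \<Phi> (c \<cdot>\<^sub>m A) = c \<cdot>\<^sub>m \<Phi> A)"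

text \<open>The basis vector \<open>|i\<rangle> \<otimes> |\<mu>\<rangle>\<close> of \<open>\<complex>\<^sup>k \<otimes> \<complex>\<^sup>N\<close> has index \<open>i * N + \<mu>\<close>, so an operator on
  this space is a \<open>k \<times> k\<close> array of \<open>N \<times> N\<close> blocks, and \<open>ampliation N k \<Phi>\<close>, which is
  \<open>id\<^sub>k \<otimes> \<Phi>\<close>, applies \<open>\<Phi>\<close> to each block.\<close>

definition mat_block :: "nat \<Rightarrow> complex mat \<Rightarrow> nat \<Rightarrow> nat \<Rightarrow> complex mat" where
  "mat_block N X i j = mat N N (\<lambda>(\<mu>, \<nu>). X $$ (i * N + \<mu>, j * N + \<nu>))"

definition ampliation ::
    "nat \<Rightarrow> nat \<Rightarrow> (complex mat \<Rightarrow> complex mat) \<Rightarrow> complex mat \<Rightarrow> complex mat" where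
  "ampliation N k \<Phi> X =
     mat (k * N) (k * N)
       (\<lambda>(r, s). \<Phi> (mat_block N X (r div N) (s div N)) $$ (r mod N, s mod N))"

definition completely_positive :: "nat \<Rightarrow> (complex mat \<Rightarrow> complex mat) \<Rightarrow> bool" where
  "completely_positive N \<Phi> \<longleftrightarrow>
     linear_op_map N \<Phi> \<and>
     (\<forall>k X. positive_op (k * N) X \<longrightarrow> positive_op (k * N) (ampliation N k \<Phi> X))"

definition trace_preserving :: "nat \<Rightarrow> (complex mat \<Rightarrow> complex mat) \<Rightarrow> bool" where
  "trace_preserving N \<Phi> \<longleftrightarrow> (\<forall>A \<in> carrier_mat N N. mat_trace (\<Phi> A) = mat_trace A)"

definition cptp :: "nat \<Rightarrow> (complex mat \<Rightarrow> complex mat) \<Rightarrow> bool" where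
  "cptp N \<Phi> \<longleftrightarrow> completely_positive N \<Phi> \<and> trace_preserving N \<Phi>"

definition kraus_representation ::
    "nat \<Rightarrow> (complex mat \<Rightarrow> complex mat) \<Rightarrow> nat \<Rightarrow> (nat \<Rightarrow> complex mat) \<Rightarrow> bool" where
  "kraus_representation N \<Phi> m K \<longleftrightarrow>
     (\<forall>a < m. K a \<in> carrier_mat N N) \<and>
     (\<forall>\<rho> \<in> carrier_mat N N. \<Phi> \<rho> = mat_sum N (\<lambda>a. K a * \<rho> * mat_adjoint (K a)) {..<m})"

text \<open>The results \<open>K \<delta> K\<^sup>\<dagger>\<close> and \<open>K\<^sup>\<dagger> \<delta> K\<close> are only required to be diagonal: they are incoherent
  up to normalization, and may be zero.\<close>

definition SIO :: "nat \<Rightarrow> (complex mat \<Rightarrow> complex mat) \<Rightarrow> bool" where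
  "SIO N \<Phi> \<longleftrightarrow>
     cptp N \<Phi> \<and>
     (\<exists>m K. kraus_representation N \<Phi> m K \<and>
        (\<forall>a < m. \<forall>\<delta> \<in> incoherent_states N.
           diagonal_mat (K a * \<delta> * mat_adjoint (K a)) \<and>
           diagonal_mat (mat_adjoint (K a) * \<delta> * K a)))"

definition GIO :: "nat \<Rightarrow> (complex mat \<Rightarrow> complex mat) \<Rightarrow> bool" where
  "GIO N \<Phi> \<longleftrightarrow> SIO N \<Phi> \<and> (\<forall>\<delta> \<in> incoherent_states N. \<Phi> \<delta> = \<delta>)"

text \<open>For Hermitian \<open>\<rho>\<close> the second summand of the off-diagonal part is the Hermitian conjugate
  of the first; in the form below it extends linearly to all operators.\<close>

definition aqnn_form ::
    "nat \<Rightarrow> (nat \<Rightarrow> nat \<Rightarrow> complex) \<Rightarrow> complex mat \<Rightarrow> complex mat" where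
  "aqnn_form N \<alpha> \<rho> =
     mat_sum N (\<lambda>\<mu>. \<rho> $$ (\<mu>, \<mu>) \<cdot>\<^sub>m ketbra N \<mu> \<mu>) {..<N} +
     mat_sum N
       (\<lambda>(\<mu>, \<nu>).
          (\<rho> $$ (\<mu>, \<nu>) * (1 + \<alpha> \<mu> \<nu>)) \<cdot>\<^sub>m ketbra N \<mu> \<nu> +
          (\<rho> $$ (\<nu>, \<mu>) * (1 + cnj (\<alpha> \<mu> \<nu>))) \<cdot>\<^sub>m ketbra N \<nu> \<mu>)
       {(\<mu>, \<nu>). \<mu> < \<nu> \<and> \<nu> < N}"

definition aQNN ::
    "nat \<Rightarrow> (nat \<Rightarrow> nat \<Rightarrow> complex) \<Rightarrow> (complex mat \<Rightarrow> complex mat) \<Rightarrow> bool" where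
  "aQNN N \<alpha> \<Lambda> \<longleftrightarrow> cptp N \<Lambda> \<and> (\<forall>\<rho> \<in> carrier_mat N N. \<Lambda> \<rho> = aqnn_form N \<alpha> \<rho>)"

end

theory Submission
  imports Defs
begin

text \<open>\<open>\<Lambda>\<close> multiplies \<open>\<rho>\<close> entrywise by a matrix \<open>M\<close> with unit diagonal, and \<open>M\<close> is the image of the
  positive all-ones matrix, hence positive semidefinite. A Gram decomposition
  \<open>M\<^sub>i\<^sub>j = \<Sum>\<^sub>a d\<^sub>a(i) cnj (d\<^sub>a(j))\<close> then gives the diagonal Kraus operators \<open>K\<^sub>a = diag d\<^sub>a\<close>.\<close>

section \<open>Gram decomposition of positive semidefinite matrices\<close>

text \<open>On vectors \<open>t e_i + e_k\<close> the form is a quadratic in \<open>t\<close>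
  without constant term, so for small \<open>t\<close> the linear part
  \<open>2 Re (cnj t * M i k)\<close> dominates and can be made negative unless
  \<open>M i k = 0\<close>. This handles a vanishing pivot in the decomposition below.\<close>

lemma psd_zero_diagonal:
  fixes M :: "nat \<Rightarrow> nat \<Rightarrow> complex"
  assumes herm: "\<And>i j. i < n \<Longrightarrow> j < n \<Longrightarrow> M j i = cnj (M i j)"
    and psd: "\<And>x. 0 \<le> Re (\<Sum>i<n. \<Sum>j<n. cnj (x i) * M i j * x j)"
    and k: "k < n" "M k k = 0" and i: "i < n"
  shows "M i k = 0"
proof (rule ccontr)
  assume nz: "M i k \<noteq> 0"
  then have ik: "i \<noteq> k" using k by auto
  have form: "(\<Sum>p<n. \<Sum>q<n. cnj (x p) * M p q * x q) =
      cnj t * M i i * t + cnj t * M i k + M k i * t"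
    if x: "x = (\<lambda>p. if p = i then t else if p = k then 1 else 0)" for x t
  proof -
    have "(\<Sum>p<n. \<Sum>q<n. cnj (x p) * M p q * x q) =
        (\<Sum>p\<in>{i,k}. \<Sum>q\<in>{i,k}. cnj (x p) * M p q * x q)"
    proof -
      have "(\<Sum>p<n. \<Sum>q<n. cnj (x p) * M p q * x q) =
          (\<Sum>p\<in>{i,k}. \<Sum>q<n. cnj (x p) * M p q * x q)"
        by (rule sum.mono_neutral_right) (use i k x in auto)
      also have "\<dots> = (\<Sum>p\<in>{i,k}. \<Sum>q\<in>{i,k}. cnj (x p) * M p q * x q)"
        by (intro sum.cong refl sum.mono_neutral_right) (use i k x in auto)
      finally show ?thesis .
    qed
    then show ?thesis using ik k x by (simp add: algebra_simps)
  qed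
  define m where "m = (cmod (M i k))\<^sup>2"
  define b where "b = Re (M i i)"
  have mpos: "m > 0" using nz by (simp add: m_def)
  have mm: "M i k * cnj (M i k) = of_real m"
    by (simp only: m_def complex_norm_square)
  have ineq: "0 \<le> s\<^sup>2 * m * b - 2 * s * m" for s :: real
  proof -
    \<comment> \<open>This phase makes both cross terms equal to \<open>- s * m\<close>, hence real,
      and leaves a quadratic inequality in the real parameter \<open>s\<close>.\<close>
    define t where "t = - of_real s * M i k"
    have "cnj t * M i i * t + cnj t * M i k + M k i * t =
        of_real (s\<^sup>2) * (M i k * cnj (M i k)) * M i i - 2 * of_real s * (M i k * cnj (M i k))"
      using herm[OF i k(1)] by (simp add: t_def algebra_simps power2_eq_square)
    also have "\<dots> = of_real (s\<^sup>2 * m) * M i i - of_real (2 * s * m)"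
      unfolding mm by (simp add: algebra_simps)
    finally have "Re (cnj t * M i i * t + cnj t * M i k + M k i * t) = s\<^sup>2 * m * b - 2 * s * m"
      by (simp add: b_def)
    then show ?thesis
      using psd[of "\<lambda>p. if p = i then t else if p = k then 1 else 0"]
      by (subst (asm) form[OF refl, of t]) simp
  qed
  \<comment> \<open>Small enough that the linear term wins, whatever the sign of \<open>b\<close>;
    the \<open>+ 1\<close> covers \<open>b = 0\<close>.\<close>
  define s where "s = 1 / (\<bar>b\<bar> + 1)"
  have s: "s > 0" "s * b \<le> 1"
    by (auto simp: s_def field_simps)
  have "s\<^sup>2 * m * b - 2 * s * m = s * m * (s * b - 2)"
    by (simp add: algebra_simps power2_eq_square)
  also have "\<dots> < 0" using s mpos by (intro mult_pos_neg) auto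
  finally show False using ineq[of s] by simp
qed

text \<open>Cholesky's algorithm as an induction on \<open>n\<close>: the last column, scaled by the
  root of the pivot, gives one vector, and subtracting its rank-one matrix leaves a Schur complement
  that is again positive semidefinite on the first \<open>n\<close> indices. Taking \<open>M\<close>
  as a function on indices allows this restriction without reindexing.\<close>

lemma psd_gram_decomposition:
  fixes M :: "nat \<Rightarrow> nat \<Rightarrow> complex"
  assumes "\<And>i j. i < n \<Longrightarrow> j < n \<Longrightarrow> M j i = cnj (M i j)"
    and "\<And>x. 0 \<le> Re (\<Sum>i<n. \<Sum>j<n. cnj (x i) * M i j * x j)"
  shows "\<exists>d :: nat \<Rightarrow> nat \<Rightarrow> complex. \<forall>i<n. \<forall>j<n. M i j = (\<Sum>a<n. d a i * cnj (d a j))"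
  using assms
proof (induction n arbitrary: M)
  case 0
  then show ?case by simp
next
  case (Suc n)
  note herm = Suc.prems(1) and psd = Suc.prems(2)
  define r where "r = Re (M n n)"
  have Mnn: "M n n = of_real r"
    using herm[of n n] by (simp add: r_def complex_eq_iff)
  have r0: "r \<ge> 0"
  proof -
    have "(\<Sum>i<Suc n. \<Sum>j<Suc n. cnj (if i = n then 1 else 0) * M i j * (if j = n then 1 else 0)) = M n n"
      by simp
    then show ?thesis using psd[of "\<lambda>i. if i = n then 1 else 0"] by (simp add: r_def)
  qed
  have zero: "M i n = 0" if "r = 0" "i < Suc n" for i
    using psd_zero_diagonal[OF herm psd, of n i] that Mnn by simp
  \<comment> \<open>For \<open>r = 0\<close> division by zero gives \<open>c i = 0\<close>, which
    agrees with the vanishing column in \<open>zero\<close>, so both cases share one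
    definition.\<close>
  define c where "c i = M i n / of_real (sqrt r)" for i
  have cc: "c i * cnj (c j) = M i n * cnj (M j n) / of_real r" for i j
    using r0 by (simp add: c_def flip: of_real_mult)
  define M' where "M' i j = M i j - c i * cnj (c j)" for i j
  have "\<exists>d :: nat \<Rightarrow> nat \<Rightarrow> complex. \<forall>i<n. \<forall>j<n. M' i j = (\<Sum>a<n. d a i * cnj (d a j))"
  proof (rule Suc.IH)
    show "M' j i = cnj (M' i j)" if "i < n" "j < n" for i j
      using herm[of i j] that by (simp add: M'_def)
  next
    fix x :: "nat \<Rightarrow> complex"
    define S where "S = (\<Sum>j<n. cnj (M j n) * x j)"
    \<comment> \<open>The value at \<open>n\<close> that minimizes the form; for \<open>r = 0\<close> it is \<open>0 / 0 = 0\<close>, which also works.\<close>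
    define y where "y = x(n := - S / of_real r)"
    have S': "(\<Sum>i<n. cnj (x i) * M i n) = cnj S"
      by (simp add: S_def mult.commute)
    have S0: "S = 0" if "r = 0"
      using zero[OF that] by (simp add: S_def)
    \<comment> \<open>Completing the square: the form of \<open>M\<close> at \<open>y\<close> equals
      the form of the Schur complement \<open>M'\<close> at \<open>x\<close>, so positivity passes
      from \<open>M\<close> to \<open>M'\<close>.\<close>
    have "(\<Sum>i<Suc n. \<Sum>j<Suc n. cnj (y i) * M i j * y j) =
        (\<Sum>i<n. (\<Sum>j<n. cnj (x i) * M i j * x j) + cnj (x i) * M i n * y n) +
        ((\<Sum>j<n. cnj (y n) * M n j * x j) + cnj (y n) * M n n * y n)"
      by (simp add: y_def)
    also have "\<dots> =
        (\<Sum>i<n. \<Sum>j<n. cnj (x i) * M i j * x j) + (\<Sum>i<n. cnj (x i) * M i n) * y n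
        + cnj (y n) * (\<Sum>j<n. M n j * x j) + cnj (y n) * M n n * y n"
      by (simp add: sum.distrib sum_distrib_left sum_distrib_right mult.assoc)
    also have "(\<Sum>j<n. M n j * x j) = S"
      unfolding S_def by (intro sum.cong refl) (use herm[of _ n] in simp)
    also have "(\<Sum>i<n. \<Sum>j<n. cnj (x i) * M i j * x j) + (\<Sum>i<n. cnj (x i) * M i n) * y n
        + cnj (y n) * S + cnj (y n) * M n n * y n =
        (\<Sum>i<n. \<Sum>j<n. cnj (x i) * M i j * x j) - cnj S * S / of_real r"
      using S0 by (cases "r = 0") (simp_all add: S' Mnn y_def field_simps)
    also have "cnj S * S / of_real r = (\<Sum>i<n. \<Sum>j<n. cnj (x i) * (c i * cnj (c j)) * x j)"
      unfolding S'[symmetric] unfolding S_def cc sum_product sum_divide_distrib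
      by (intro sum.cong refl) simp
    also have "(\<Sum>i<n. \<Sum>j<n. cnj (x i) * M i j * x j) - \<dots> =
        (\<Sum>i<n. \<Sum>j<n. cnj (x i) * M' i j * x j)"
      by (simp add: M'_def algebra_simps sum_subtractf)
    finally show "0 \<le> Re (\<Sum>i<n. \<Sum>j<n. cnj (x i) * M' i j * x j)"
      using psd[of y] by simp
  qed
  then obtain d :: "nat \<Rightarrow> nat \<Rightarrow> complex"
    where d: "\<And>i j. i < n \<Longrightarrow> j < n \<Longrightarrow> M' i j = (\<Sum>a<n. d a i * cnj (d a j))"
    by blast
  \<comment> \<open>The old vectors are padded with 0 at index \<open>n\<close>, so they leave the
    last row and column untouched; \<open>c\<close> joins them as vector number
    \<open>n\<close>.\<close>
  define e where "e a i = (if a < n then if i < n then d a i else 0 else c i)" for a i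
  \<comment> \<open>Since \<open>c n\<close> is the root of the pivot, \<open>c\<close> alone
    reproduces the last column.\<close>
  have last: "M i n = c i * cnj (c n)" if "i < Suc n" for i
    using zero[OF _ that] by (cases "r = 0") (simp_all add: cc Mnn)
  have "M i j = (\<Sum>a<Suc n. e a i * cnj (e a j))" if ij: "i < Suc n" "j < Suc n" for i j
  proof (cases "i < n \<and> j < n")
    case True
    then show ?thesis using d[of i j] by (simp add: e_def M'_def algebra_simps)
  next
    case False
    then have "(\<Sum>a<n. e a i * cnj (e a j)) = 0"
      by (intro sum.neutral) (auto simp: e_def)
    moreover have "M i j = c i * cnj (c j)"
    proof (cases "j = n")
      case True
      then show ?thesis using last ij by simp
    next
      case False
      then have "i = n" using \<open>\<not> (i < n \<and> j < n)\<close> ij by auto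
      then show ?thesis using last[OF ij(2)] herm[of j n] ij by simp
    qed
    ultimately show ?thesis by (simp add: e_def)
  qed
  then show ?case by blast
qed

section \<open>Positivity and the entrywise action of the map\<close>

lemma quadratic_form_sum:
  assumes "A \<in> carrier_mat n n" "v \<in> carrier_vec n"
  shows "(A *\<^sub>v v) \<bullet>c v = (\<Sum>i<n. \<Sum>j<n. cnj (v $ i) * A $$ (i, j) * v $ j)"
  using assms
  by (auto simp: scalar_prod_def atLeast0LessThan sum_distrib_left sum_distrib_right mult_ac
      intro!: sum.cong)

text \<open>The matrix has rank one, and its form is the squared modulus of the sum of the
  coordinates.\<close>

lemma positive_op_ones: "positive_op n (mat n n (\<lambda>_. 1))"
  unfolding positive_op_def
proof (intro conjI ballI)
  fix v :: "complex vec" assume v: "v \<in> carrier_vec n"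
  define s where "s = (\<Sum>j<n. v $ j)"
  have "(mat n n (\<lambda>_. 1) *\<^sub>v v) \<bullet>c v = cnj s * s"
    using v by (subst quadratic_form_sum) (auto simp: s_def sum_product)
  also have "\<dots> = of_real ((cmod s)\<^sup>2)"
    by (simp only: complex_norm_square mult.commute)
  finally show "0 \<le> (mat n n (\<lambda>_. 1) *\<^sub>v v) \<bullet>c v" by (simp add: less_eq_complex_def)
qed simp

text \<open>Brings complete positivity down to positivity of the map itself.\<close>

lemma ampliation_1:
  assumes "X \<in> carrier_mat N N" "\<Phi> X \<in> carrier_mat N N"
  shows "ampliation N 1 \<Phi> X = \<Phi> X"
proof -
  have "mat_block N X 0 0 = X"
    using assms by (intro eq_matI) (auto simp: mat_block_def)
  then show ?thesis
    using assms by (intro eq_matI) (auto simp: ampliation_def)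
qed

text \<open>Exhibits the network as a Schur (Hadamard) multiplier: only one ketbra term of the
  defining sums reaches a given entry.\<close>

lemma aqnn_form_entry:
  assumes "i < N" "j < N"
  shows "aqnn_form N \<alpha> \<rho> $$ (i, j) =
    \<rho> $$ (i, j) * (if i = j then 1 else if i < j then 1 + \<alpha> i j else 1 + cnj (\<alpha> j i))"
proof -
  let ?P = "{(\<mu>, \<nu>). \<mu> < \<nu> \<and> \<nu> < N}"
  have fin: "finite ?P"
    by (rule finite_subset[of _ "{..<N} \<times> {..<N}"]) auto
  define A where "A = (\<lambda>\<mu>. \<rho> $$ (\<mu>, \<mu>) \<cdot>\<^sub>m ketbra N \<mu> \<mu>)"
  define B where "B = (\<lambda>(\<mu>, \<nu>).
    (\<rho> $$ (\<mu>, \<nu>) * (1 + \<alpha> \<mu> \<nu>)) \<cdot>\<^sub>m ketbra N \<mu> \<nu> +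
    (\<rho> $$ (\<nu>, \<mu>) * (1 + cnj (\<alpha> \<mu> \<nu>))) \<cdot>\<^sub>m ketbra N \<nu> \<mu>)"
  have dim: "dim_row (ketbra N \<mu> \<nu>) = N" "dim_col (ketbra N \<mu> \<nu>) = N" for \<mu> \<nu>
    by (simp_all add: ketbra_def)
  have ket: "ketbra N \<mu> \<nu> $$ (i, j) = (if i = \<mu> \<and> j = \<nu> then 1 else 0)" for \<mu> \<nu>
    using assms by (simp add: ketbra_def)
  have A: "A \<mu> $$ (i, j) = (if \<mu> = i then if i = j then \<rho> $$ (i, j) else 0 else 0)" for \<mu>
    using assms by (simp add: A_def dim ket)
  \<comment> \<open>Conditions of the shape \<open>p = (i, j)\<close> let each sum over pairs
    collapse to at most one term.\<close>
  have B: "B p $$ (i, j) =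
      (if p = (i, j) then \<rho> $$ (i, j) * (1 + \<alpha> i j) else 0) +
      (if p = (j, i) then \<rho> $$ (i, j) * (1 + cnj (\<alpha> j i)) else 0)" for p
  proof (cases p)
    case (Pair \<mu> \<nu>)
    have "B p $$ (i, j) = \<rho> $$ (\<mu>, \<nu>) * (1 + \<alpha> \<mu> \<nu>) * (if i = \<mu> \<and> j = \<nu> then 1 else 0) +
        \<rho> $$ (\<nu>, \<mu>) * (1 + cnj (\<alpha> \<mu> \<nu>)) * (if i = \<nu> \<and> j = \<mu> then 1 else 0)"
      using assms by (simp add: B_def Pair dim ket)
    also have "\<rho> $$ (\<mu>, \<nu>) * (1 + \<alpha> \<mu> \<nu>) * (if i = \<mu> \<and> j = \<nu> then 1 else 0) =
        (if p = (i, j) then \<rho> $$ (i, j) * (1 + \<alpha> i j) else 0)"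
      unfolding Pair by (rule trans[OF if_distrib]) auto
    also have "\<rho> $$ (\<nu>, \<mu>) * (1 + cnj (\<alpha> \<mu> \<nu>)) * (if i = \<nu> \<and> j = \<mu> then 1 else 0) =
        (if p = (j, i) then \<rho> $$ (i, j) * (1 + cnj (\<alpha> j i)) else 0)"
      unfolding Pair by (rule trans[OF if_distrib]) auto
    finally show ?thesis .
  qed
  have "aqnn_form N \<alpha> \<rho> = mat_sum N A {..<N} + mat_sum N B ?P"
    unfolding aqnn_form_def A_def B_def ..
  then have "aqnn_form N \<alpha> \<rho> $$ (i, j) = (\<Sum>\<mu><N. A \<mu> $$ (i, j)) + (\<Sum>p\<in>?P. B p $$ (i, j))"
    using assms by (simp add: mat_sum_def)
  then show ?thesis
    using assms fin by (auto simp: A B sum.distrib)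
qed

text \<open>With \<open>f\<close> and \<open>g\<close> independent, this serves both orders of
  \<open>K a\<close> and its adjoint.\<close>

lemma diag_conj_entry:
  fixes \<rho> :: "complex mat"
  assumes "\<rho> \<in> carrier_mat N N" "i < N" "j < N"
    and "A = mat N N (\<lambda>(i, j). if i = j then f i else 0)"
    and "B = mat N N (\<lambda>(i, j). if i = j then g i else 0)"
  shows "(A * \<rho> * B) $$ (i, j) = f i * \<rho> $$ (i, j) * g j"
proof -
  have left: "(A * \<rho>) $$ (p, q) = f p * \<rho> $$ (p, q)" if "p < N" "q < N" for p q
  proof -
    have "(A * \<rho>) $$ (p, q) = (\<Sum>k<N. (if p = k then f p else 0) * \<rho> $$ (k, q))"
      using that assms by (simp add: scalar_prod_def atLeast0LessThan)
    also have "\<dots> = (\<Sum>k<N. if k = p then f p * \<rho> $$ (p, q) else 0)"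
      by (rule sum.cong) auto
    finally show ?thesis using that by simp
  qed
  have "(A * \<rho> * B) $$ (i, j) = (\<Sum>k<N. (A * \<rho>) $$ (i, k) * (if k = j then g k else 0))"
    using assms by (simp add: scalar_prod_def atLeast0LessThan)
  also have "\<dots> = (\<Sum>k<N. if k = j then f i * \<rho> $$ (i, j) * g j else 0)"
    by (rule sum.cong) (use left assms in auto)
  finally show ?thesis using assms by simp
qed

lemma mat_adjoint_diag:
  "mat_adjoint (mat N N (\<lambda>(i, j). if i = j then f i else 0)) =
    mat N N (\<lambda>(i, j). if i = j then cnj (f i) else (0 :: complex))"
  by (intro eq_matI) (auto simp: mat_adjoint_def mat_of_rows_def)

section \<open>Diagonal Kraus operators and fixed incoherent states\<close>

theorem mainTheorem1:
  fixes N :: nat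
    and \<alpha> :: "nat \<Rightarrow> nat \<Rightarrow> complex"
    and \<Lambda> :: "complex mat \<Rightarrow> complex mat"
  assumes "N \<ge> 2"
    and "aQNN N \<alpha> \<Lambda>"
  shows "GIO N \<Lambda>"
proof -
  define M where "M i j = (if i = j then 1 else if i < j then 1 + \<alpha> i j else 1 + cnj (\<alpha> j i))"
    for i j
  have cptp: "cptp N \<Lambda>" and form: "\<And>\<rho>. \<rho> \<in> carrier_mat N N \<Longrightarrow> \<Lambda> \<rho> = aqnn_form N \<alpha> \<rho>"
    using assms(2) by (auto simp: aQNN_def)
  have carrier: "\<Lambda> \<rho> \<in> carrier_mat N N" if "\<rho> \<in> carrier_mat N N" for \<rho>
    using cptp that by (auto simp: cptp_def completely_positive_def linear_op_map_def)
  have entry: "\<Lambda> \<rho> $$ (i, j) = \<rho> $$ (i, j) * M i j"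
    if "\<rho> \<in> carrier_mat N N" "i < N" "j < N" for \<rho> i j
    using that by (simp add: form aqnn_form_entry M_def)
  have "\<exists>d :: nat \<Rightarrow> nat \<Rightarrow> complex. \<forall>i<N. \<forall>j<N. M i j = (\<Sum>a<N. d a i * cnj (d a j))"
  proof (rule psd_gram_decomposition)
    show "M j i = cnj (M i j)" for i j
      by (auto simp: M_def)
  next
    fix x :: "nat \<Rightarrow> complex"
    \<comment> \<open>Entrywise multiplication turns the all-ones matrix into \<open>M\<close>, so
      positivity of \<open>\<Lambda> ?J\<close> is positivity of the form of
      \<open>M\<close>.\<close>
    let ?J = "mat N N (\<lambda>_. 1) :: complex mat"
    have J: "?J \<in> carrier_mat N N" by simp
    have "positive_op (1 * N) (ampliation N 1 \<Lambda> ?J)"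
      using cptp positive_op_ones[of N] unfolding cptp_def completely_positive_def
      by (metis mult_1)
    then have "positive_op N (\<Lambda> ?J)"
      using ampliation_1[of ?J N \<Lambda>, OF J carrier[OF J]] by simp
    then have "0 \<le> (\<Lambda> ?J *\<^sub>v vec N x) \<bullet>c vec N x"
      by (auto simp: positive_op_def)
    also have "\<dots> = (\<Sum>i<N. \<Sum>j<N. cnj (x i) * M i j * x j)"
      by (subst quadratic_form_sum[OF carrier[OF J]]) (auto simp: entry intro!: sum.cong)
    finally show "0 \<le> Re (\<Sum>i<N. \<Sum>j<N. cnj (x i) * M i j * x j)"
      by (simp add: less_eq_complex_def)
  qed
  then obtain d :: "nat \<Rightarrow> nat \<Rightarrow> complex"
    where d: "\<And>i j. i < N \<Longrightarrow> j < N \<Longrightarrow> M i j = (\<Sum>a<N. d a i * cnj (d a j))"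
    by blast
  define K where "K a = mat N N (\<lambda>(i, j). if i = j then d a i else 0)" for a
  have K: "K a \<in> carrier_mat N N" "mat_adjoint (K a) \<in> carrier_mat N N" for a
    by (simp_all add: K_def mat_adjoint_diag)
  have K1: "(K a * \<rho> * mat_adjoint (K a)) $$ (i, j) = d a i * \<rho> $$ (i, j) * cnj (d a j)"
    and K2: "(mat_adjoint (K a) * \<rho> * K a) $$ (i, j) = cnj (d a i) * \<rho> $$ (i, j) * d a j"
    if "\<rho> \<in> carrier_mat N N" "i < N" "j < N" for \<rho> a i j
    by (rule diag_conj_entry[OF that]; simp add: K_def mat_adjoint_diag)+
  have incoherent: "\<delta> \<in> carrier_mat N N" "diagonal_mat \<delta>"
    if "\<delta> \<in> incoherent_states N" for \<delta>
    using that by (auto simp: incoherent_states_def density_op_def positive_op_def)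
  have "kraus_representation N \<Lambda> N K"
    unfolding kraus_representation_def
  proof (intro conjI allI impI ballI K)
    fix \<rho> :: "complex mat" assume \<rho>: "\<rho> \<in> carrier_mat N N"
    show "\<Lambda> \<rho> = mat_sum N (\<lambda>a. K a * \<rho> * mat_adjoint (K a)) {..<N}"
    proof (rule eq_matI)
      fix i j assume "i < dim_row (mat_sum N (\<lambda>a. K a * \<rho> * mat_adjoint (K a)) {..<N})"
        and "j < dim_col (mat_sum N (\<lambda>a. K a * \<rho> * mat_adjoint (K a)) {..<N})"
      then have ij: "i < N" "j < N" by (simp_all add: mat_sum_def)
      \<comment> \<open>Summing \<open>d a i * cnj (d a j)\<close> over \<open>a\<close> restores
        the multiplier \<open>M i j\<close>.\<close>
      then show "\<Lambda> \<rho> $$ (i, j) = mat_sum N (\<lambda>a. K a * \<rho> * mat_adjoint (K a)) {..<N} $$ (i, j)"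
        by (simp add: mat_sum_def K1[OF \<rho>] entry[OF \<rho>] d sum_distrib_left mult_ac
            del: index_mult_mat)
    qed (use carrier[OF \<rho>] in \<open>auto simp: mat_sum_def\<close>)
  qed
  \<comment> \<open>Both conjugations only rescale entries, so the zeros of \<open>\<delta>\<close>
    off the diagonal survive.\<close>
  moreover have "diagonal_mat (K a * \<delta> * mat_adjoint (K a)) \<and>
      diagonal_mat (mat_adjoint (K a) * \<delta> * K a)" if "\<delta> \<in> incoherent_states N" for a \<delta>
  proof -
    have "\<delta> $$ (i, j) = 0" if "i < N" "j < N" "i \<noteq> j" for i j
      using incoherent[OF \<open>\<delta> \<in> incoherent_states N\<close>] that by (auto simp: diagonal_mat_def)
    moreover have "dim_row (K a) = N" "dim_col (K a) = N"
      "dim_row (mat_adjoint (K a)) = N" "dim_col (mat_adjoint (K a)) = N"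
      using K[of a] by auto
    ultimately show ?thesis
      using K1[OF incoherent(1)[OF that]] K2[OF incoherent(1)[OF that]]
      by (simp add: diagonal_mat_def del: index_mult_mat(1))
  qed
  \<comment> \<open>The multiplier is 1 on the diagonal, and \<open>\<delta>\<close> vanishes
    elsewhere.\<close>
  moreover have "\<Lambda> \<delta> = \<delta>" if "\<delta> \<in> incoherent_states N" for \<delta>
  proof (rule eq_matI)
    note \<delta> = incoherent[OF that]
    show "\<Lambda> \<delta> $$ (i, j) = \<delta> $$ (i, j)" if "i < dim_row \<delta>" "j < dim_col \<delta>" for i j
      using \<delta> that entry[OF \<delta>(1), of i j] by (cases "i = j") (auto simp: M_def diagonal_mat_def)
  qed (use carrier incoherent(1)[OF that] in auto)
  ultimately show ?thesis
    using cptp unfolding GIO_def SIO_def by blast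
qed

end
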